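(* Let $T$ be a maximal monotone operator on a real linear topological space $X$, and let $\mathcal{F}_T$ and $\mathcal{J}$ be the Fitzpatrick family of $T$ and the map on $\bar{\mathbb{R}}^{X\times X^*}$ defined in the context. 1. If $g\in\mathcal{F}_T$ and $\mathcal{J}g\leq g$, then there exists $h\in\mathcal{F}_T$ such that $\mathcal{J}g\leq\mathcal{J}h=h\leq g$. 2. If $g\in\mathcal{J}(\mathcal{F}_T)$ and $g\leq\mathcal{J}g$, then there exists $h\in\mathcal{F}_T$ such that $g\leq h=\mathcal{J}h\leq\mathcal{J}g$. In particular, there exists $h\in\mathcal{F}_T$ such that $h=\mathcal{J}h$.
   Context: $\bar{\mathbb{R}}=\mathbb{R}\cup\{-\infty,\infty\}$; $\bar{\mathbb{R}}^{A}$ is the set of functions $A\to\bar{\mathbb{R}}$, ordered pointwise. $X$ is a real linear topological space (not assumed Hausdorff or locally convex), $X^*$ is its topological dual endowed with the weak-$*$ topology, $X\times X^*$ carries the product topology, and $\langle x,x^*\rangle=x^*(x)$ for $x\in X$, $x^*\in X^*$. A (point-to-set) operator $T:X\rightrightarrows X^*$ is a subset $T\subset X\times X^*$. It is monotone if $\langle x-y,x^*-y^*\rangle\ge 0$ for all $(x,x^* ),(y,y^* )\in T$, and maximal monotone if it is monotone and maximal under inclusion among monotone subsets of $X\times X^*$. $\mathcal{F}_T$ is the set of all $h\in\bar{\mathbb{R}}^{X\times X^*}$ such that: $h$ is convex and lower semicontinuous; $\langle x,x^*\rangle\le h(x,x^* )$ for all $(x,x^* )\in X\times X^*$; and $h(x,x^*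 )=\langle x,x^*\rangle$ whenever $(x,x^* )\in T$. The map $\mathcal{J}:\bar{\mathbb{R}}^{X\times X^*}\to\bar{\mathbb{R}}^{X\times X^*}$ is $\mathcal{J}h(x,x^* )=\sup_{(y,y^* )\in X\times X^*}\{\langle x,y^*\rangle+\langle y,x^*\rangle-h(y,y^* )\}$. *)

theory Defs
  imports "HOL-Analysis.Analysis"
begin

text \<open>Neither a separation axiom nor local convexity is assumed.\<close>

class real_topological_vector = real_vector + topological_ab_group_add +
  assumes tendsto_scaleR_Pair:
    "LIM p (nhds c \<times>\<^sub>F nhds x). fst p *\<^sub>R snd p :> nhds (c *\<^sub>R x)"

instance real_normed_vector \<subseteq> real_topological_vector
proof
  fix c :: real and x :: 'a
  have "((\<lambda>p. fst p *\<^sub>R snd p) \<longlongrightarrow> c *\<^sub>R x) (nhds (c, x))"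
    by (intro tendsto_scaleR tendsto_fst[where a = "(c, x)", simplified]
        tendsto_snd[where a = "(c, x)", simplified] filterlim_ident)
  then show "LIM p (nhds c \<times>\<^sub>F nhds x). fst p *\<^sub>R snd p :> nhds (c *\<^sub>R x)"
    by (simp add: nhds_prod)
qed

typedef (overloaded) 'a topological_dual =
  "{f :: 'a::real_topological_vector \<Rightarrow> real. linear f \<and> continuous_on UNIV f}"
  morphisms dual_apply Abs_dual
  by (rule exI[of _ "\<lambda>_. 0"]) (simp add: linear_zero)

setup_lifting type_definition_topological_dual

instantiation topological_dual :: (real_topological_vector) real_vector
begin

lift_definition zero_topological_dual :: "'a topological_dual" is "\<lambda>_. 0"
  by (simp add: linear_zero)

lift_definition plus_topological_dual ::
  "'a topological_dual \<Rightarrow> 'a topological_dual \<Rightarrow> 'a topological_dual" is "\<lambda>f g x. f x + g x"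
  by (auto intro: linear_compose_add continuous_on_add)

lift_definition uminus_topological_dual ::
  "'a topological_dual \<Rightarrow> 'a topological_dual" is "\<lambda>f x. - f x"
  by (auto intro: linear_compose_neg continuous_on_minus)

lift_definition minus_topological_dual ::
  "'a topological_dual \<Rightarrow> 'a topological_dual \<Rightarrow> 'a topological_dual" is "\<lambda>f g x. f x - g x"
  by (auto intro: linear_compose_sub continuous_on_diff)

lift_definition scaleR_topological_dual ::
  "real \<Rightarrow> 'a topological_dual \<Rightarrow> 'a topological_dual" is "\<lambda>c f x. c *\<^sub>R f x"
  by (auto simp: linear_iff algebra_simps intro: continuous_on_mult_left)

instance
  by standard (transfer; simp add: fun_eq_iff algebra_simps)+

end

text \<open>The weak-* topology: the topology induced by \<open>dual_apply\<close> from the topology of pointwise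
  convergence (the product topology) on \<open>'a \<Rightarrow> real\<close>.\<close>

instantiation topological_dual :: (real_topological_vector) topological_space
begin

definition open_topological_dual :: "'a topological_dual set \<Rightarrow> bool" where
  "open U \<longleftrightarrow> openin (pullback_topology UNIV dual_apply euclidean) U"

instance
proof
  show "open (UNIV :: 'a topological_dual set)"
    using openin_topspace[of "pullback_topology UNIV (dual_apply :: 'a topological_dual \<Rightarrow> _) euclidean"]
    by (simp add: open_topological_dual_def topspace_pullback_topology)
qed (auto simp: open_topological_dual_def)

end

definition pairing :: "'a::real_topological_vector \<Rightarrow> 'a topological_dual \<Rightarrow> real" where
  "pairing x xs = dual_apply xs x"

definition monotone_operator ::
  "('a::real_topological_vector \<times> 'a topological_dual) set \<Rightarrow> bool" where
  "monotone_operator T \<longleftrightarrow>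
     (\<forall>(x, xs) \<in> T. \<forall>(y, ys) \<in> T. 0 \<le> pairing (x - y) (xs - ys))"

definition maximal_monotone ::
  "('a::real_topological_vector \<times> 'a topological_dual) set \<Rightarrow> bool" where
  "maximal_monotone T \<longleftrightarrow>
     monotone_operator T \<and> (\<forall>S. monotone_operator S \<and> T \<subseteq> S \<longrightarrow> S = T)"

text \<open>Convexity is convexity of the epigraph in \<open>'b \<times> real\<close>, which needs no convention for
  \<open>\<infinity> - \<infinity>\<close>.\<close>

definition ereal_convex :: "('b::real_vector \<Rightarrow> ereal) \<Rightarrow> bool" where
  "ereal_convex h \<longleftrightarrow> convex {(z, r :: real). h z \<le> ereal r}"

definition ereal_lsc :: "('b::topological_space \<Rightarrow> ereal) \<Rightarrow> bool" where
  "ereal_lsc h \<longleftrightarrow> (\<forall>r :: ereal. open {z. r < h z})"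

definition fitzpatrick_family ::
  "('a::real_topological_vector \<times> 'a topological_dual) set \<Rightarrow>
     ('a \<times> 'a topological_dual \<Rightarrow> ereal) set" where
  "fitzpatrick_family T =
     {h. ereal_convex h \<and> ereal_lsc h \<and>
         (\<forall>x xs. ereal (pairing x xs) \<le> h (x, xs)) \<and>
         (\<forall>(x, xs) \<in> T. h (x, xs) = ereal (pairing x xs))}"

definition conj_map ::
  "('a::real_topological_vector \<times> 'a topological_dual \<Rightarrow> ereal) \<Rightarrow>
     ('a \<times> 'a topological_dual \<Rightarrow> ereal)" where
  "conj_map h = (\<lambda>(x, xs). SUP (y, ys). ereal (pairing x ys + pairing y xs) - h (y, ys))"

end

theory Submission
  imports Defs
begin

text \<open>Writing \<open>b((x, x*), (y, y*)) = \<langle>x, y*\<rangle> + \<langle>y, x*\<rangle>\<close>, the inequality \<open>\<J> g \<le> g\<close> says that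
  \<open>b(p, q) \<le> c + d\<close> for any two points \<open>(p, c)\<close>, \<open>(q, d)\<close> of the epigraph of \<open>g\<close>. Zorn's lemma
  enlarges this epigraph to a maximal set \<open>E\<close> with that property. If the values of \<open>g\<close> on \<open>T\<close> are at
  most the pairing, maximal monotonicity of \<open>T\<close> shows that a point \<open>(p, c)\<close> compatible with all
  of \<open>E\<close> satisfies \<open>\<langle>x, x*\<rangle> \<le> c\<close> for \<open>p = (x, x*)\<close>, hence is compatible with itself and lies
  in \<open>E\<close>. So \<open>E\<close> is the epigraph of a function \<open>h \<le> g\<close> with \<open>\<J> h = h\<close>, which is convex and lower
  semicontinuous as a value of \<open>\<J>\<close>. The first assertion is this with \<open>g\<close> itself, the second with
  \<open>\<J> g\<close>, and the third with the function equal to the pairing on \<open>T\<close> and to \<open>\<infinity>\<close> elsewhere.\<close>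

section \<open>The duality pairing, the coupling and their continuity\<close>

lemma pairing_simps:
  "pairing (x + y) xs = pairing x xs + pairing y xs"
  "pairing (x - y) xs = pairing x xs - pairing y xs"
  "pairing (r *\<^sub>R x) xs = r * pairing x xs"
  "pairing x (xs + ys) = pairing x xs + pairing x ys"
  "pairing x (xs - ys) = pairing x xs - pairing x ys"
  "pairing x (r *\<^sub>R xs) = r * pairing x xs"
proof -
  have "linear (dual_apply xs)"
    using dual_apply by blast
  then show "pairing (x + y) xs = pairing x xs + pairing y xs"
    "pairing (x - y) xs = pairing x xs - pairing y xs"
    "pairing (r *\<^sub>R x) xs = r * pairing x xs"
    by (simp_all add: pairing_def linear_add linear_diff linear_cmul)
qed (simp_all add: pairing_def plus_topological_dual.rep_eq minus_topological_dual.rep_eq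
      scaleR_topological_dual.rep_eq)

lemma continuous_pairing_left: "continuous_on UNIV (\<lambda>x. pairing x xs)"
  using dual_apply[of xs] by (simp add: pairing_def)

lemma continuous_pairing_right: "continuous_on UNIV (pairing x)"
proof -
  have "open (pairing x -` U)" if "open U" for U :: "real set"
  proof -
    have "open ((\<lambda>f :: 'a \<Rightarrow> real. f x) -` U)"
      by (intro open_vimage[OF that] continuous_on_product_coordinates)
    then show ?thesis
      unfolding open_topological_dual_def openin_pullback_topology
      by (intro exI[of _ "(\<lambda>f. f x) -` U"]) (auto simp: pairing_def)
  qed
  then show ?thesis
    by (simp add: continuous_on_open_vimage)
qed

text \<open>This symmetric bilinear form puts the product space in duality with itself, and
  \<open>conj_map\<close> is Fenchel conjugation for that duality.\<close>

definition coupling ::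
  "'a::real_topological_vector \<times> 'a topological_dual \<Rightarrow> 'a \<times> 'a topological_dual \<Rightarrow> real" where
  "coupling p q = pairing (fst p) (snd q) + pairing (fst q) (snd p)"

lemma coupling_commute: "coupling p q = coupling q p"
  by (simp add: coupling_def)

lemma coupling_self: "coupling p p = 2 * pairing (fst p) (snd p)"
  by (simp add: coupling_def)

lemma coupling_convex_combination:
  "coupling (u *\<^sub>R p + v *\<^sub>R p') q = u * coupling p q + v * coupling p' q"
  by (simp add: coupling_def pairing_simps algebra_simps)

lemma continuous_coupling: "continuous_on UNIV (\<lambda>p. coupling p q)"
  unfolding coupling_def
  by (intro continuous_on_add
      continuous_on_compose2[OF continuous_pairing_left continuous_on_fst[OF continuous_on_id]]
      continuous_on_compose2[OF continuous_pairing_right continuous_on_snd[OF continuous_on_id]])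
    auto

section \<open>Conjugation: convexity, semicontinuity and order properties\<close>

lemma conj_map_eq: "conj_map h p = (SUP q. ereal (coupling p q) - h q)"
  by (simp add: conj_map_def coupling_def case_prod_beta)

text \<open>Describes the real epigraph of a conjugate by constraints on \<open>h\<close>. As
  \<open>r\<close> and the coupling are finite, they can be moved across the inequality even where
  \<open>h q\<close> is infinite.\<close>

lemma conj_map_le_real_iff:
  "conj_map h p \<le> ereal r \<longleftrightarrow> (\<forall>q. ereal (coupling p q - r) \<le> h q)"
proof -
  have "ereal (coupling p q) - h q \<le> ereal r \<longleftrightarrow> ereal (coupling p q - r) \<le> h q" for q
    by (cases "h q") auto
  then show ?thesis
    by (simp add: conj_map_eq SUP_le_iff)
qed

lemma ereal_le_iff_real:
  fixes a b :: ereal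
  shows "a \<le> b \<longleftrightarrow> (\<forall>r. b \<le> ereal r \<longrightarrow> a \<le> ereal r)"
  by (meson ereal_le_real order_trans)

text \<open>The epigraph is an intersection over \<open>q\<close> of sets that are closed
  half-spaces for finite \<open>h q\<close>, and empty or everything otherwise.\<close>

lemma ereal_convex_conj_map:
  fixes h :: "'a::real_topological_vector \<times> 'a topological_dual \<Rightarrow> ereal"
  shows "ereal_convex (conj_map h)"
proof -
  have "convex {(p, r). ereal (coupling p q - r) \<le> h q}" for q
  proof (cases "h q")
    case (real s)
    show ?thesis
    proof (rule convexI)
      fix z w :: "('a \<times> 'a topological_dual) \<times> real" and u v :: real
      assume "z \<in> {(p, r). ereal (coupling p q - r) \<le> h q}"
        "w \<in> {(p, r). ereal (coupling p q - r) \<le> h q}"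
        and uv: "0 \<le> u" "0 \<le> v" "u + v = 1"
      then have "coupling (fst z) q - snd z \<le> s" "coupling (fst w) q - snd w \<le> s"
        by (simp_all add: real case_prod_beta)
      then have "u * (coupling (fst z) q - snd z) + v * (coupling (fst w) q - snd w) \<le> s"
        using uv by (rule convex_bound_le)
      then show "u *\<^sub>R z + v *\<^sub>R w \<in> {(p, r). ereal (coupling p q - r) \<le> h q}"
        by (simp add: real case_prod_beta coupling_convex_combination algebra_simps)
    qed
  qed (auto simp: convex_def)
  then have "convex (\<Inter>q. {(p, r). ereal (coupling p q - r) \<le> h q})"
    by (intro convex_INT) simp
  moreover have "{(p, r). conj_map h p \<le> ereal r} = (\<Inter>q. {(p, r). ereal (coupling p q - r) \<le> h q})"
    by (auto simp: conj_map_le_real_iff)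
  ultimately show ?thesis
    by (simp add: ereal_convex_def)
qed

text \<open>A supremum exceeds \<open>r\<close> iff some member does, and each member is continuous
  or constantly infinite in \<open>p\<close>.\<close>

lemma ereal_lsc_conj_map: "ereal_lsc (conj_map h)"
  unfolding ereal_lsc_def
proof
  fix r :: ereal
  have "open {p. r < ereal (coupling p q) - h q}" for q
  proof (cases "h q")
    case (real s)
    have "continuous_on UNIV (\<lambda>p. ereal (coupling p q - s))"
      by (intro continuous_on_ereal continuous_on_diff continuous_coupling continuous_on_const)
    then show ?thesis
      by (simp add: real open_Collect_less)
  qed auto
  then have "open (\<Union>q. {p. r < ereal (coupling p q) - h q})"
    by blast
  moreover have "{p. r < conj_map h p} = (\<Union>q. {p. r < ereal (coupling p q) - h q})"
    by (auto simp: conj_map_eq less_SUP_iff)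
  ultimately show "open {p. r < conj_map h p}"
    by simp
qed

lemma conj_map_antimono:
  assumes "g \<le> h"
  shows "conj_map h \<le> conj_map g"
  using assms by (auto simp: le_fun_def conj_map_eq intro!: SUP_mono' ereal_minus_mono)

text \<open>This is the Fenchel-Young inequality: any real \<open>r\<close> above \<open>h p\<close>
  gives the lower bound \<open>coupling p q - r\<close> for \<open>conj_map h q\<close>, by symmetry
  of the coupling.\<close>

lemma conj_map_conj_map_le: "conj_map (conj_map h) \<le> h"
proof (rule le_funI)
  fix p
  show "conj_map (conj_map h) p \<le> h p"
  proof (subst ereal_le_iff_real, intro allI impI)
    fix r assume r: "h p \<le> ereal r"
    have "ereal (coupling p q - r) \<le> conj_map h q" for q
    proof -
      have "ereal (coupling p q - r) \<le> ereal (coupling q p) - h p"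
        using r by (cases "h p") (auto simp: coupling_commute)
      also have "\<dots> \<le> conj_map h q"
        unfolding conj_map_eq by (rule SUP_upper) simp
      finally show ?thesis .
    qed
    then show "conj_map (conj_map h) p \<le> ereal r"
      by (simp add: conj_map_le_real_iff)
  qed
qed

lemma conj_map_conj_map_conj_map: "conj_map (conj_map (conj_map h)) = conj_map h"
  by (intro antisym conj_map_conj_map_le conj_map_antimono)

section \<open>Monotone operators and fixed points of the conjugation\<close>

lemma monotone_operator_iff:
  "monotone_operator T \<longleftrightarrow>
    (\<forall>p \<in> T. \<forall>q \<in> T. coupling p q \<le> pairing (fst p) (snd p) + pairing (fst q) (snd q))"
proof -
  have "0 \<le> pairing (fst p - fst q) (snd p - snd q) \<longleftrightarrow>
      coupling p q \<le> pairing (fst p) (snd p) + pairing (fst q) (snd q)"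
    for p q :: "'a \<times> 'a topological_dual"
    by (auto simp: coupling_def pairing_simps)
  then show ?thesis
    by (simp add: monotone_operator_def case_prod_beta)
qed

text \<open>If \<open>c\<close> were below the pairing at \<open>p\<close>, the bound would make
  \<open>p\<close> monotonically related to all of \<open>T\<close>, so \<open>p\<close> would
  belong to \<open>T\<close> by maximality.\<close>

lemma maximal_monotone_pairing_le:
  assumes "maximal_monotone T"
    and le: "\<And>q. q \<in> T \<Longrightarrow> coupling p q \<le> c + pairing (fst q) (snd q)"
  shows "pairing (fst p) (snd p) \<le> c"
proof (rule ccontr)
  assume less: "\<not> ?thesis"
  have mono: "monotone_operator T"
    using assms(1) by (simp add: maximal_monotone_def)
  have "coupling p q \<le> pairing (fst p) (snd p) + pairing (fst q) (snd q)" if "q \<in> T" for q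
    using le[OF that] less by simp
  then have "monotone_operator (insert p T)"
    using mono by (simp add: monotone_operator_iff coupling_self coupling_commute[of _ p] add.commute)
  then have "p \<in> T"
    using assms(1) unfolding maximal_monotone_def by blast
  \<comment> \<open>The bound at \<open>q = p\<close> compares twice the pairing with
    \<open>c\<close> plus the pairing.\<close>
  then show False
    using le[of p] less by (simp add: coupling_self)
qed

text \<open>Serves all three assertions: the hypotheses on \<open>g\<close> hold for a member of the
  family, for a conjugate, and for a function that is infinite off \<open>T\<close>.\<close>

lemma exists_fixed_point_below:
  fixes T :: "('a::real_topological_vector \<times> 'a topological_dual) set"
  assumes T: "maximal_monotone T"
    and g: "conj_map g \<le> g"
    and g_T: "\<And>x xs. (x, xs) \<in> T \<Longrightarrow> g (x, xs) \<le> ereal (pairing x xs)"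
  shows "\<exists>h \<in> fitzpatrick_family T. conj_map h = h \<and> h \<le> g"
proof -
  \<comment> \<open>The two points may coincide, so compatibility also forces \<open>c\<close> to be
    at least the pairing at \<open>p\<close>.\<close>
  define compatible where "compatible E \<longleftrightarrow> (\<forall>(p, c) \<in> E. \<forall>(q, d) \<in> E. coupling p q \<le> c + d)"
    for E :: "(('a \<times> 'a topological_dual) \<times> real) set"
  define epi where "epi = {(p, c :: real). g p \<le> ereal c}"
  have "coupling p q \<le> c + d" if "g p \<le> ereal c" "g q \<le> ereal d" for p q c d
  proof -
    have "conj_map g p \<le> ereal c"
      using g that(1) by (meson le_funD order_trans)
    then have "ereal (coupling p q - c) \<le> g q"
      unfolding conj_map_le_real_iff by blast
    also note that(2)
    finally show ?thesis
      by simp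
  qed
  then have "compatible epi"
    by (auto simp: compatible_def epi_def)
  have "\<exists>E \<in> {E. epi \<subseteq> E \<and> compatible E}. \<forall>F \<in> {E. epi \<subseteq> E \<and> compatible E}. E \<subseteq> F \<longrightarrow> F = E"
  proof (rule subset_Zorn_nonempty)
    show "{E. epi \<subseteq> E \<and> compatible E} \<noteq> {}"
      using \<open>compatible epi\<close> by blast
    fix C assume "C \<noteq> {}" and C: "subset.chain {E. epi \<subseteq> E \<and> compatible E} C"
    have "coupling p q \<le> c + d" if "(p, c) \<in> E" "E \<in> C" "(q, d) \<in> F" "F \<in> C" for p q c d E F
    proof -
      have "E \<subseteq> F \<or> F \<subseteq> E" "compatible E" "compatible F"
        using C that unfolding subset_chain_def by blast+
      then show ?thesis
        using that unfolding compatible_def by blast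
    qed
    then have "compatible (\<Union>C)"
      unfolding compatible_def by blast
    moreover have "epi \<subseteq> \<Union>C"
      using C \<open>C \<noteq> {}\<close> unfolding subset_chain_def by blast
    ultimately show "\<Union>C \<in> {E. epi \<subseteq> E \<and> compatible E}"
      by blast
  qed
  then obtain E where E: "E \<in> {E. epi \<subseteq> E \<and> compatible E}"
    and max: "\<forall>F \<in> {E. epi \<subseteq> E \<and> compatible E}. E \<subseteq> F \<longrightarrow> F = E"
    by (rule bexE)
  then have epi: "epi \<subseteq> E" and comp: "compatible E"
    by simp_all
  have pairing_le: "pairing (fst p) (snd p) \<le> c"
    if "\<And>q d. (q, d) \<in> E \<Longrightarrow> coupling p q \<le> c + d" for p c
  proof (rule maximal_monotone_pairing_le[OF T])
    fix q assume "q \<in> T"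
    then have "(q, pairing (fst q) (snd q)) \<in> E"
      using epi g_T[of "fst q" "snd q"] by (auto simp: epi_def)
    then show "coupling p q \<le> c + pairing (fst q) (snd q)"
      by (rule that)
  qed
  have E_iff: "(p, c) \<in> E \<longleftrightarrow> (\<forall>(q, d) \<in> E. coupling p q \<le> c + d)" for p c
  proof
    assume *: "\<forall>(q, d) \<in> E. coupling p q \<le> c + d"
    then have "pairing (fst p) (snd p) \<le> c"
      by (intro pairing_le) auto
    then have "coupling p p \<le> c + c"
      by (simp add: coupling_self)
    moreover have "coupling q p \<le> d + c" if "(q, d) \<in> E" for q d
      using * that by (auto simp: coupling_commute[of q p])
    ultimately have "compatible (insert (p, c) E)"
      using * comp by (auto simp: compatible_def)
    then show "(p, c) \<in> E"
      using bspec[OF max, of "insert (p, c) E"] epi by auto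
  qed (use comp in \<open>auto simp: compatible_def\<close>)
  \<comment> \<open>As a supremum, rather than an infimum of heights over \<open>p\<close>,
    \<open>h\<close> has exactly \<open>E\<close> as its real epigraph by \<open>E_iff\<close>, with
    no separate closedness argument.\<close>
  define h where "h p = (SUP (q, d) \<in> E. ereal (coupling p q - d))" for p
  have h_le: "h p \<le> ereal r \<longleftrightarrow> (p, r) \<in> E" for p r
    unfolding E_iff[of p r] h_def by (auto simp: SUP_le_iff algebra_simps)
  \<comment> \<open>Both sides say that \<open>(p, r)\<close> is compatible with every point of
    \<open>E\<close>.\<close>
  have "conj_map h p \<le> ereal r \<longleftrightarrow> h p \<le> ereal r" for p r
    unfolding conj_map_le_real_iff ereal_le_iff_real[of _ "h _"] h_le E_iff[of p r]
    by (auto simp: algebra_simps)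
  then have fixed: "conj_map h = h"
    by (intro ext antisym; subst ereal_le_iff_real) auto
  have "h p \<le> g p" for p
    by (subst ereal_le_iff_real) (use epi in \<open>auto simp: h_le epi_def\<close>)
  then have "h \<le> g"
    by (rule le_funI)
  have pairing_le_h: "ereal (pairing (fst p) (snd p)) \<le> h p" for p
    by (subst ereal_le_iff_real) (auto simp: h_le E_iff intro!: pairing_le)
  have "ereal_convex h" "ereal_lsc h"
    using ereal_convex_conj_map[of h] ereal_lsc_conj_map[of h] by (simp_all add: fixed)
  moreover have "ereal (pairing x xs) \<le> h (x, xs)" for x xs
    using pairing_le_h[of "(x, xs)"] by simp
  moreover have "h (x, xs) = ereal (pairing x xs)" if "(x, xs) \<in> T" for x xs
    using pairing_le_h[of "(x, xs)"] \<open>h \<le> g\<close> g_T[OF that]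
    by (auto intro: antisym order_trans dest: le_funD)
  ultimately have "h \<in> fitzpatrick_family T"
    by (auto simp: fitzpatrick_family_def)
  then show ?thesis
    using fixed \<open>h \<le> g\<close> by blast
qed

theorem theorem4p4:
  fixes T :: "('a::real_topological_vector \<times> 'a topological_dual) set"
  assumes "maximal_monotone T"
  shows "(\<forall>g \<in> fitzpatrick_family T. conj_map g \<le> g \<longrightarrow>
            (\<exists>h \<in> fitzpatrick_family T.
               conj_map g \<le> conj_map h \<and> conj_map h = h \<and> h \<le> g)) \<and>
         (\<forall>g \<in> conj_map ` fitzpatrick_family T. g \<le> conj_map g \<longrightarrow>
            (\<exists>h \<in> fitzpatrick_family T.
               g \<le> h \<and> h = conj_map h \<and> conj_map h \<le> conj_map g)) \<and>
         (\<exists>h \<in> fitzpatrick_family T. h = conj_map h)"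
proof (intro conjI ballI impI)
  fix g assume "g \<in> fitzpatrick_family T" "conj_map g \<le> g"
  then have "\<exists>h \<in> fitzpatrick_family T. conj_map h = h \<and> h \<le> g"
    by (intro exists_fixed_point_below[OF assms]) (auto simp: fitzpatrick_family_def)
  then show "\<exists>h \<in> fitzpatrick_family T. conj_map g \<le> conj_map h \<and> conj_map h = h \<and> h \<le> g"
    using conj_map_antimono by blast
next
  fix g assume "g \<in> conj_map ` fitzpatrick_family T" and le: "g \<le> conj_map g"
  then obtain f where f: "f \<in> fitzpatrick_family T" "g = conj_map f"
    by blast
  \<comment> \<open>Turns the hypothesis on \<open>g\<close> into the one that
    \<open>exists_fixed_point_below\<close> asks of \<open>conj_map g\<close>.\<close>
  have closed: "conj_map (conj_map g) = g"
    by (simp add: f(2) conj_map_conj_map_conj_map)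
  have "conj_map g (x, xs) \<le> ereal (pairing x xs)" if "(x, xs) \<in> T" for x xs
  proof -
    have "conj_map g (x, xs) \<le> f (x, xs)"
      unfolding f(2) by (rule le_funD[OF conj_map_conj_map_le])
    also have "\<dots> = ereal (pairing x xs)"
      using f(1) that by (auto simp: fitzpatrick_family_def)
    finally show ?thesis .
  qed
  then have "\<exists>h \<in> fitzpatrick_family T. conj_map h = h \<and> h \<le> conj_map g"
    using le by (intro exists_fixed_point_below[OF assms]) (simp_all add: closed)
  then obtain h where h: "h \<in> fitzpatrick_family T" "conj_map h = h" "h \<le> conj_map g"
    by blast
  moreover have "g \<le> h"
    using conj_map_antimono[OF h(3)] by (simp add: closed h(2))
  ultimately show "\<exists>h \<in> fitzpatrick_family T. g \<le> h \<and> h = conj_map h \<and> conj_map h \<le> conj_map g"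
    by auto
next
  have mono: "monotone_operator T"
    using assms by (simp add: maximal_monotone_def)
  \<comment> \<open>The conjugate of \<open>f\<close> is the Fitzpatrick function of
    \<open>T\<close>. Monotonicity gives the required inequality on \<open>T\<close>, and the value
    infinity makes it trivial elsewhere.\<close>
  define f where "f p = (if p \<in> T then ereal (pairing (fst p) (snd p)) else \<infinity>)" for p
  have "ereal (coupling p q - pairing (fst p) (snd p)) \<le> f q" if "p \<in> T" for p q
    using mono that by (simp add: f_def monotone_operator_iff diff_le_eq add.commute)
  then have "conj_map f p \<le> f p" for p
    by (cases "p \<in> T") (simp_all add: f_def[of p] conj_map_le_real_iff del: split_paired_All)
  then have "\<exists>h \<in> fitzpatrick_family T. conj_map h = h \<and> h \<le> f"
    by (intro exists_fixed_point_below[OF assms]) (auto simp: f_def le_fun_def)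
  then show "\<exists>h \<in> fitzpatrick_family T. h = conj_map h"
    by metis
qed

end
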